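(* Fix $\alpha,\beta>0$. For $n\ge3$ let $S$ be a random $\alpha/\beta$-staircase tableau of size $n$ with law $\mathbb{P}_{n,\alpha,\beta}$, and let $X_n^{(3)}$ be the number of non-empty boxes among the boxes $(n-j-1,j)$, $1\le j\le n-2$ (the third main diagonal). Then, as $n\to\infty$, $X_n^{(3)}$ converges in distribution to a Poisson random variable with parameter $1$.
   Context: A staircase tableau of size $n$ has boxes $(i,j)$ with $i,j\ge1$ and $i+j\le n+1$, rows numbered from the top and columns from the left. An $\alpha/\beta$-staircase tableau of size $n$ is a filling in which each box is empty or contains $\alpha$ or $\beta$, such that: all boxes in the same column and above an $\alpha$ are empty; all boxes in the same row and to the left of a $\beta$ are empty; every main-diagonal box (with $i+j=n+1$) contains a symbol. $\overline{\mathcal{S}}_n$ is the set of these. The weight is $wt(S)=\alpha^{N_\alpha}\beta^{N_\beta}$ ($N_\alpha,N_\beta$ the numbers of $\alpha$'s, $\beta$'s), and $\mathbb{P}_{n,\alpha,\beta}(S)=wt(S)/\sum_{T\in\overline{\mathcal{S}}_n}wt(T)$. *)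

theory Defs
  imports "HOL-Probability.Probability"
begin

datatype sym = Alpha | Beta

text \<open>A filling is a function (row i, column j) to an optional symbol (None = empty box).
  Rows and columns are numbered from 1.\<close>
type_synonym filling = "nat \<Rightarrow> nat \<Rightarrow> sym option"

definition in_stair :: "nat \<Rightarrow> nat \<Rightarrow> nat \<Rightarrow> bool" where
  "in_stair n i j \<longleftrightarrow> 1 \<le> i \<and> 1 \<le> j \<and> i + j \<le> n + 1"

definition is_ab_staircase :: "nat \<Rightarrow> filling \<Rightarrow> bool" where
  "is_ab_staircase n T \<longleftrightarrow>
     (\<forall>i j. \<not> in_stair n i j \<longrightarrow> T i j = None) \<and>
     (\<forall>i j. T i j = Some Alpha \<longrightarrow> (\<forall>i'. 1 \<le> i' \<and> i' < i \<longrightarrow> T i' j = None)) \<and>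
     (\<forall>i j. T i j = Some Beta \<longrightarrow> (\<forall>j'. 1 \<le> j' \<and> j' < j \<longrightarrow> T i j' = None)) \<and>
     (\<forall>i j. in_stair n i j \<and> i + j = n + 1 \<longrightarrow> T i j \<noteq> None)"

definition ab_staircases :: "nat \<Rightarrow> filling set" where
  "ab_staircases n = {T. is_ab_staircase n T}"

definition num_sym :: "nat \<Rightarrow> sym \<Rightarrow> filling \<Rightarrow> nat" where
  "num_sym n s T = card {(i, j). in_stair n i j \<and> T i j = Some s}"

definition wt :: "nat \<Rightarrow> real \<Rightarrow> real \<Rightarrow> filling \<Rightarrow> real" where
  "wt n \<alpha> \<beta> T = \<alpha> ^ num_sym n Alpha T * \<beta> ^ num_sym n Beta T"

definition Z :: "nat \<Rightarrow> real \<Rightarrow> real \<Rightarrow> real" where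
  "Z n \<alpha> \<beta> = (\<Sum>T\<in>ab_staircases n. wt n \<alpha> \<beta> T)"

definition stair_pmf :: "nat \<Rightarrow> real \<Rightarrow> real \<Rightarrow> filling pmf" where
  "stair_pmf n \<alpha> \<beta> = embed_pmf
     (\<lambda>T. if T \<in> ab_staircases n then wt n \<alpha> \<beta> T / Z n \<alpha> \<beta> else 0)"

definition X3 :: "nat \<Rightarrow> filling \<Rightarrow> nat" where
  "X3 n T = card {j \<in> {1..n - 2}. T (n - j - 1) j \<noteq> None}"

definition X3_law :: "nat \<Rightarrow> real \<Rightarrow> real \<Rightarrow> real measure" where
  "X3_law n \<alpha> \<beta> = measure_pmf (map_pmf (\<lambda>T. real (X3 n T)) (stair_pmf n \<alpha> \<beta>))"

end

theory Submission
  imports Defs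
begin

text \<open>
  Call a row free if it contains no \<open>\<beta>\<close>. Deleting the first column of a tableau leaves a tableau
  of size one less, and the deleted column can carry symbols only in its lowest box and in the
  free rows. Let \<open>\<Phi>\<^sub>m(x; u, v)\<close> be the sum of \<open>wt(T) y^X3(T)\<close> over the tableaux of size \<open>m\<close>, with an
  extra factor \<open>x\<close> for every free row, except that the lowest row counts \<open>u\<close> and the last but one
  counts \<open>v\<close>; these two rows decide whether a column receives a symbol on the third diagonal.
  Summing over the deleted column gives a recurrence for \<open>\<Phi>\<close>, from which \<open>u\<close> and \<open>v\<close> can be
  eliminated.

  For \<open>y = 1\<close> the recurrence is solved by a Pochhammer product. Dividing by it at \<open>x = 1 + k \<beta>\<close> and
  setting \<open>\<eta> = y - 1\<close>, \<open>N = s + k\<close>, \<open>c = 1/\<alpha> + 1/\<beta>\<close> yields, for size \<open>s\<close>,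
  \<open>g(s,k) = g(s-1,k+1) + \<eta> g(s-3,k+2) / (c+N-1) + (\<eta>\<^sup>2 g(s-4,k+2) + \<eta> g(s-3,k+1)) / ((c+N-1)(c+N-2))\<close>,
  where \<open>g(n,0)\<close> is the expectation of \<open>y^X3\<close>. The function \<open>exp (\<eta> s / N)\<close> satisfies this up to
  \<open>O(N\<^sup>-\<^sup>2)\<close>, so a discrete Gronwall argument gives \<open>g(n,0) \<longrightarrow> exp \<eta>\<close>, and for \<open>y = exp(it)\<close> Levy's
  continuity theorem applies.
\<close>

section \<open>Removing the first column\<close>

definition free_rows :: "nat \<Rightarrow> filling \<Rightarrow> nat set" where
  "free_rows m T = {i \<in> {1..m}. \<forall>j. T i j \<noteq> Some Beta}"

text \<open>Only the condition on \<alpha> appears: a \<beta> in the first column has no box to its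
  left.\<close>

definition columns_on :: "nat set \<Rightarrow> (nat \<Rightarrow> sym option) set" where
  "columns_on I = {c. (\<forall>i. i \<notin> I \<longrightarrow> c i = None) \<and>
     (\<forall>i i'. c i = Some Alpha \<longrightarrow> i' < i \<longrightarrow> c i' = None)}"

lemma columns_onI:
  assumes "\<And>i. i \<notin> I \<Longrightarrow> c i = None" "\<And>i i'. c i = Some Alpha \<Longrightarrow> i' < i \<Longrightarrow> c i' = None"
  shows "c \<in> columns_on I"
  using assms unfolding columns_on_def by blast

lemma columns_onD:
  assumes "c \<in> columns_on I"
  shows "i \<notin> I \<Longrightarrow> c i = None" "c i = Some Alpha \<Longrightarrow> i' < i \<Longrightarrow> c i' = None"
  using assms unfolding columns_on_def by blast+

definition cons_col :: "(nat \<Rightarrow> sym option) \<Rightarrow> filling \<Rightarrow> filling" where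
  "cons_col c T = (\<lambda>i j. if j = 0 then None else if j = 1 then c i else T i (j - 1))"

text \<open>In use \<open>b\<close> is the bottom row \<open>Suc m\<close>, whose box in the first
  column lies on the main diagonal and so must carry a symbol.\<close>

definition full_columns :: "nat \<Rightarrow> nat set \<Rightarrow> (nat \<Rightarrow> sym option) set" where
  "full_columns b I = {c \<in> columns_on (insert b I). c b \<noteq> None}"

lemma free_rows_subset: "free_rows m T \<subseteq> {1..m}"
  by (auto simp: free_rows_def)

lemma finite_free_rows [simp]: "finite (free_rows m T)"
  by (auto simp: free_rows_def)

text \<open>An \<alpha> in the bottom box empties the rest of the column, whereas a \<beta> there
  restricts nothing above it.\<close>

lemma full_columns_eq:
  assumes "\<And>i. i \<in> I \<Longrightarrow> i < b"
  shows "full_columns b I =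
    insert ((\<lambda>_. None)(b := Some Alpha)) ((\<lambda>c. c(b := Some Beta)) ` columns_on I)"
    (is "?L = ?R")
proof
  have "c(b := Some Beta) \<in> ?L" if c: "c \<in> columns_on I" for c
  proof -
    have less: "i < b" if "c i = Some Alpha" for i
      using columns_onD(1)[OF c, of i] assms[of i] that by force
    have "(c(b := Some Beta)) i' = None" if "(c(b := Some Beta)) i = Some Alpha" "i' < i" for i i'
      using that less[of i] columns_onD(2)[OF c, of i i'] by (simp split: if_splits)
    then have "c(b := Some Beta) \<in> columns_on (insert b I)"
      by (intro columns_onI) (use columns_onD(1)[OF c] in auto)
    then show ?thesis by (simp add: full_columns_def)
  qed
  moreover have "(\<lambda>_. None)(b := Some Alpha) \<in> ?L"
    by (auto simp: full_columns_def columns_on_def)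
  ultimately show "?R \<subseteq> ?L" by blast
  show "?L \<subseteq> ?R"
  proof
    fix c assume c: "c \<in> ?L"
    have "c \<in> columns_on (insert b I)" and nb: "c b \<noteq> None"
      using c unfolding full_columns_def by blast+
    note out = columns_onD(1)[OF this(1)] and up = columns_onD(2)[OF this(1)]
    show "c \<in> ?R"
    proof (cases "c b = Some Alpha")
      case True
      have "c i = None" if "i \<noteq> b" for i
        using up[OF True, of i] out[of i] assms[of i] that by blast
      then have "c = (\<lambda>_. None)(b := Some Alpha)"
        using True by (auto simp: fun_eq_iff)
      then show ?thesis by blast
    next
      case False
      then have b: "c b = Some Beta" using nb by (metis not_None_eq sym.exhaust)
      have "c(b := None) \<in> columns_on I"
      proof (rule columns_onI)
        show "(c(b := None)) i = None" if "i \<notin> I" for i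
          using that out[of i] by simp
        show "(c(b := None)) i' = None" if "(c(b := None)) i = Some Alpha" "i' < i" for i i'
          using that up[of i i'] by (simp split: if_splits)
      qed
      moreover have "c = (c(b := None))(b := Some Beta)"
        using b by (auto simp: fun_eq_iff)
      ultimately show ?thesis by blast
    qed
  qed
qed

lemma columns_on_insert:
  assumes "\<And>i. i \<in> I \<Longrightarrow> i < b"
  shows "columns_on (insert b I) = columns_on I \<union> full_columns b I"
proof -
  have "b \<notin> I" using assms by blast
  have "c \<in> columns_on (insert b I) \<longleftrightarrow> c \<in> columns_on I" if "c b = None" for c
  proof -
    have "(\<forall>i. i \<notin> insert b I \<longrightarrow> c i = None) \<longleftrightarrow> (\<forall>i. i \<notin> I \<longrightarrow> c i = None)"
      using that by (metis insert_iff)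
    then show ?thesis by (simp only: columns_on_def mem_Collect_eq)
  qed
  moreover have "c b = None" if "c \<in> columns_on I" for c
    using columns_onD(1)[OF that] \<open>b \<notin> I\<close> by blast
  ultimately show ?thesis
    unfolding full_columns_def by blast
qed

lemma finite_columns_on: "finite I \<Longrightarrow> finite (columns_on I)"
proof (induction I rule: finite_linorder_max_induct)
  case empty
  have "columns_on {} \<subseteq> {\<lambda>_. None}" by (auto simp: columns_on_def)
  then show ?case using finite_subset by blast
next
  case (insert b I)
  then show ?case by (simp add: columns_on_insert full_columns_eq)
qed

lemma sum_full_columns:
  fixes f :: "nat \<Rightarrow> sym option \<Rightarrow> 'a::comm_ring_1"
  assumes "finite I" and less: "\<And>i. i \<in> I \<Longrightarrow> i < b"
  shows "(\<Sum>c\<in>full_columns b I. \<Prod>i\<in>insert b I. f i (c i)) =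
    f b (Some Alpha) * (\<Prod>i\<in>I. f i None) +
    f b (Some Beta) * (\<Sum>c\<in>columns_on I. \<Prod>i\<in>I. f i (c i))"
proof -
  have b: "b \<notin> I" using less by blast
  have inj: "inj_on (\<lambda>c. c(b := Some Beta)) (columns_on I)"
  proof (rule inj_onI)
    fix c c' assume *: "c \<in> columns_on I" "c' \<in> columns_on I" "c(b := Some Beta) = c'(b := Some Beta)"
    then have "c b = None" "c' b = None"
      using b columns_onD(1)[of c I b] columns_onD(1)[of c' I b] by simp_all
    then show "c = c'" using *(3) by (metis fun_upd_triv fun_upd_upd)
  qed
  have notin: "(\<lambda>_. None)(b := Some Alpha) \<notin> (\<lambda>c. c(b := Some Beta)) ` columns_on I"
    by (auto dest: fun_cong[of _ _ b])
  have upd: "(\<Prod>i\<in>I. f i ((c(b := z)) i)) = (\<Prod>i\<in>I. f i (c i))" for c z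
    using b by (intro prod.cong) auto
  have "full_columns b I = insert ((\<lambda>_. None)(b := Some Alpha)) ((\<lambda>c. c(b := Some Beta)) ` columns_on I)"
    by (rule full_columns_eq) (rule less)
  then have "(\<Sum>c\<in>full_columns b I. \<Prod>i\<in>insert b I. f i (c i)) =
    (\<Prod>i\<in>insert b I. f i (((\<lambda>_. None)(b := Some Alpha)) i)) +
    (\<Sum>c\<in>columns_on I. \<Prod>i\<in>insert b I. f i ((c(b := Some Beta)) i))"
    using notin assms(1) by (simp only: sum.insert finite_columns_on finite_imageI sum.reindex[OF inj] o_def simp_thms)
  then show ?thesis
    using assms(1) b by (simp only: prod.insert upd fun_upd_same sum_distrib_left simp_thms)
qed

text \<open>The largest row is peeled off: an empty box or a \<beta> there leaves the smaller rows
  unrestricted, an \<alpha> empties all of them.\<close>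

lemma sum_columns_on_insert:
  fixes f :: "nat \<Rightarrow> sym option \<Rightarrow> 'a::comm_ring_1"
  assumes "finite I" and less: "\<And>i. i \<in> I \<Longrightarrow> i < b"
  shows "(\<Sum>c\<in>columns_on (insert b I). \<Prod>i\<in>insert b I. f i (c i)) =
    (f b None + f b (Some Beta)) * (\<Sum>c\<in>columns_on I. \<Prod>i\<in>I. f i (c i)) +
    f b (Some Alpha) * (\<Prod>i\<in>I. f i None)"
proof -
  have b: "b \<notin> I" using less by blast
  have "columns_on I \<inter> full_columns b I = {}"
  proof (rule equals0I)
    fix c assume "c \<in> columns_on I \<inter> full_columns b I"
    then have "c \<in> columns_on I" "c b \<noteq> None" by (simp_all add: full_columns_def)
    then show False using columns_onD(1)[of c I b] b by simp
  qed
  moreover have "finite (full_columns b I)"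
    using assms(1) by (simp add: full_columns_eq[OF less] finite_columns_on)
  moreover have "(\<Prod>i\<in>insert b I. f i (c i)) = f b None * (\<Prod>i\<in>I. f i (c i))"
    if "c \<in> columns_on I" for c
    using columns_onD(1)[OF that b] b assms(1) by simp
  ultimately show ?thesis
    using assms(1)
    by (simp only: columns_on_insert[OF less] sum.union_disjoint finite_columns_on
          sum_full_columns[OF assms] sum_distrib_left[symmetric] cong: sum.cong)
       (simp add: algebra_simps)
qed

lemma full_columns_D:
  assumes "c \<in> full_columns b I"
  shows "\<And>i. i \<notin> insert b I \<Longrightarrow> c i = None" "c b \<noteq> None"
    "\<And>i i'. c i = Some Alpha \<Longrightarrow> i' < i \<Longrightarrow> c i' = None"
  using assms unfolding full_columns_def columns_on_def by blast+

section \<open>Tableaux of size \<open>Suc m\<close> as pairs of a tableau of size \<open>m\<close>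
  and a column\<close>

lemma ab_staircase_D:
  assumes "T \<in> ab_staircases n"
  shows "\<And>i j. \<not> in_stair n i j \<Longrightarrow> T i j = None"
    "\<And>i j i'. T i j = Some Alpha \<Longrightarrow> 1 \<le> i' \<Longrightarrow> i' < i \<Longrightarrow> T i' j = None"
    "\<And>i j j'. T i j = Some Beta \<Longrightarrow> 1 \<le> j' \<Longrightarrow> j' < j \<Longrightarrow> T i j' = None"
    "\<And>i j. in_stair n i j \<Longrightarrow> i + j = n + 1 \<Longrightarrow> T i j \<noteq> None"
  using assms unfolding ab_staircases_def is_ab_staircase_def by blast+

text \<open>A row with a \<beta> further right must be empty in the new column, which is why the
  column lives on the free rows; the row \<open>Suc m\<close> consists of the new box alone.\<close>

lemma cons_col_in_ab_staircases:
  assumes T: "T \<in> ab_staircases m" and c: "c \<in> full_columns (Suc m) (free_rows m T)"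
  shows "cons_col c T \<in> ab_staircases (Suc m)"
proof -
  note TD = ab_staircase_D[OF T] and cD = full_columns_D[OF c]
  have "cons_col c T i j = None" if "\<not> in_stair (Suc m) i j" for i j
  proof -
    have "c i = None" if "j = 1"
      using cD(1)[of i] that \<open>\<not> in_stair (Suc m) i j\<close> free_rows_subset[of m T]
      by (force simp: in_stair_def)
    moreover have "T i (j - 1) = None" if "j \<noteq> 1" "j \<noteq> 0"
      using that \<open>\<not> in_stair (Suc m) i j\<close> by (intro TD(1)) (auto simp: in_stair_def)
    ultimately show ?thesis by (auto simp: cons_col_def)
  qed
  moreover have "cons_col c T i' j = None"
    if "cons_col c T i j = Some Alpha" "1 \<le> i'" "i' < i" for i j i'
    using that cD(3)[of i i'] TD(2)[of i "j - 1" i'] by (auto simp: cons_col_def split: if_splits)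
  moreover have "cons_col c T i j' = None"
    if *: "cons_col c T i j = Some Beta" "1 \<le> j'" "j' < j" for i j j'
  proof -
    have b: "T i (j - 1) = Some Beta" using * by (auto simp: cons_col_def split: if_splits)
    then have "in_stair m i (j - 1)" using TD(1) by force
    then have "i \<noteq> Suc m" by (auto simp: in_stair_def)
    moreover have "i \<notin> free_rows m T" using b by (auto simp: free_rows_def)
    ultimately have "c i = None" using cD(1) by blast
    moreover have "T i (j' - 1) = None" if "j' \<noteq> 1"
      using TD(3)[OF b, of "j' - 1"] * that by auto
    ultimately show ?thesis by (auto simp: cons_col_def)
  qed
  moreover have "cons_col c T i j \<noteq> None" if "in_stair (Suc m) i j" "i + j = Suc m + 1" for i j
  proof (cases "j = 1")
    case True
    then show ?thesis using that cD(2) by (auto simp: cons_col_def)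
  next
    case False
    then show ?thesis using that TD(4)[of i "j - 1"] by (auto simp: cons_col_def in_stair_def)
  qed
  ultimately show ?thesis
    unfolding ab_staircases_def is_ab_staircase_def by blast
qed

text \<open>The left shift alone would move the first column of \<open>T\<close> to index 0, outside
  the shape; hence the explicit \<open>None\<close> in \<open>T'\<close>.\<close>

lemma ab_staircases_Suc_split:
  assumes T: "T \<in> ab_staircases (Suc m)"
  defines "T' \<equiv> \<lambda>i j. if j = 0 then None else T i (Suc j)"
  defines "c \<equiv> \<lambda>i. T i 1"
  shows "T' \<in> ab_staircases m" "c \<in> full_columns (Suc m) (free_rows m T')" "T = cons_col c T'"
proof -
  note TD = ab_staircase_D[OF T]
  have "T i 0 = None" for i using TD(1) by (auto simp: in_stair_def)
  then show "T = cons_col c T'"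
    by (auto simp: fun_eq_iff cons_col_def T'_def c_def)
  have 1: "T' i j = None" if "\<not> in_stair m i j" for i j
    using TD(1)[of i "Suc j"] that by (auto simp: T'_def in_stair_def)
  have 2: "T' i' j = None" if "T' i j = Some Alpha" "1 \<le> i'" "i' < i" for i j i'
    using that TD(2)[of i "Suc j" i'] by (auto simp: T'_def split: if_splits)
  have 3: "T' i j' = None" if "T' i j = Some Beta" "1 \<le> j'" "j' < j" for i j j'
    using that TD(3)[of i "Suc j" "Suc j'"] by (auto simp: T'_def split: if_splits)
  have 4: "T' i j \<noteq> None" if "in_stair m i j" "i + j = m + 1" for i j
    using that TD(4)[of i "Suc j"] by (auto simp: T'_def in_stair_def)
  show "T' \<in> ab_staircases m"
    unfolding ab_staircases_def is_ab_staircase_def using 1 2 3 4 by blast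
  have "c i = None" if i: "i \<notin> insert (Suc m) (free_rows m T')" for i
  proof (cases "i \<in> {1..m}")
    case True
    then obtain j where "T' i j = Some Beta" using i unfolding free_rows_def by blast
    then show ?thesis using TD(3)[of i "Suc j" 1] by (auto simp: T'_def c_def split: if_splits)
  next
    case False
    then show ?thesis using that TD(1)[of i 1] by (auto simp: c_def in_stair_def)
  qed
  moreover have "c i' = None" if "c i = Some Alpha" "i' < i" for i i'
    using that TD(1)[of i' 1] TD(2)[of i 1 i'] by (cases "i' = 0") (auto simp: c_def in_stair_def)
  moreover have "c (Suc m) \<noteq> None"
    using TD(4)[of "Suc m" 1] by (auto simp: c_def in_stair_def)
  ultimately show "c \<in> full_columns (Suc m) (free_rows m T')"
    unfolding full_columns_def columns_on_def by blast
qed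

lemma ab_staircases_Suc:
  "ab_staircases (Suc m) = (\<lambda>(T, c). cons_col c T) `
     (SIGMA T:ab_staircases m. full_columns (Suc m) (free_rows m T))"
proof (intro equalityI subsetI)
  fix T assume "T \<in> ab_staircases (Suc m)"
  from ab_staircases_Suc_split[OF this]
  show "T \<in> (\<lambda>(T, c). cons_col c T) ` (SIGMA T:ab_staircases m. full_columns (Suc m) (free_rows m T))"
    by (force simp: image_iff)
qed (auto intro: cons_col_in_ab_staircases)

lemma inj_on_cons_col:
  "inj_on (\<lambda>(T, c). cons_col c T) (SIGMA T:ab_staircases m. full_columns (Suc m) (free_rows m T))"
proof (rule inj_onI, clarify)
  fix T c T' c'
  assume T: "T \<in> ab_staircases m" "T' \<in> ab_staircases m" and eq: "cons_col c T = cons_col c' T'"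
  have eq': "cons_col c T i j = cons_col c' T' i j" for i j using eq by simp
  have "c i = c' i" for i using eq'[of i 1] by (simp add: cons_col_def)
  moreover have "T i j = T' i j" for i j
  proof (cases "j = 0")
    case True
    then show ?thesis using ab_staircase_D(1)[OF T(1), of i j] ab_staircase_D(1)[OF T(2), of i j]
      by (simp add: in_stair_def)
  next
    case False
    then show ?thesis using eq'[of i "Suc j"] by (simp add: cons_col_def)
  qed
  ultimately show "T = T' \<and> c = c'" by (auto simp: fun_eq_iff)
qed

lemma ab_staircases_0: "ab_staircases 0 = {\<lambda>_ _. None}"
  by (auto simp: ab_staircases_def is_ab_staircase_def in_stair_def fun_eq_iff)

lemma finite_full_columns: "finite I \<Longrightarrow> finite (full_columns b I)"
  by (rule finite_subset[OF _ finite_columns_on[of "insert b I"]]) (simp_all add: full_columns_def)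

lemma finite_ab_staircases [simp]: "finite (ab_staircases n)"
  by (induction n) (auto simp: ab_staircases_0 ab_staircases_Suc finite_full_columns)

section \<open>Effect of a new column on the statistics\<close>

lemma num_sym_cons_col:
  assumes T: "T \<in> ab_staircases m" and c: "c \<in> full_columns (Suc m) (free_rows m T)"
  shows "num_sym (Suc m) s (cons_col c T) =
    num_sym m s T + card {i \<in> insert (Suc m) (free_rows m T). c i = Some s}"
proof -
  let ?A = "{(i, j). in_stair m i j \<and> T i j = Some s}"
  let ?B = "{i \<in> insert (Suc m) (free_rows m T). c i = Some s}"
  have cD: "i \<in> insert (Suc m) (free_rows m T)" if "c i = Some s" for i
    using full_columns_D(1)[OF c, of i] that by auto
  have "{(i, j). in_stair (Suc m) i j \<and> cons_col c T i j = Some s} =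
    (\<lambda>(i, j). (i, Suc j)) ` ?A \<union> (\<lambda>i. (i, 1)) ` ?B" (is "?L = ?R")
  proof (intro equalityI subsetI)
    fix p assume p: "p \<in> ?L"
    obtain i j where ij: "p = (i, j)" by (cases p)
    show "p \<in> ?R"
    proof (cases "j = 1")
      case True
      then show ?thesis using p ij cD by (auto simp: cons_col_def)
    next
      case False
      then have "(i, j - 1) \<in> ?A" "j = Suc (j - 1)"
        using p ij by (auto simp: cons_col_def in_stair_def)
      then show ?thesis using ij by (auto simp: image_iff intro!: bexI[of _ "(i, j - 1)"])
    qed
  next
    fix p assume "p \<in> ?R"
    then show "p \<in> ?L"
      using free_rows_subset[of m T] by (force simp: cons_col_def in_stair_def)
  qed
  moreover have "finite ?A"
    by (rule finite_subset[of _ "{..m} \<times> {..m}"]) (auto simp: in_stair_def)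
  moreover have "(\<lambda>(i, j). (i, Suc j)) ` ?A \<inter> (\<lambda>i. (i, 1)) ` ?B = {}"
    by (auto simp: in_stair_def)
  ultimately show ?thesis
    unfolding num_sym_def
    by (simp add: card_Un_disjoint card_image inj_on_def del: One_nat_def)
qed

text \<open>The right shift carries the old third diagonal into the new one, whose only further box
  is in row \<open>m - 1\<close> of the first column.\<close>

lemma X3_cons_col:
  assumes c: "c \<in> full_columns (Suc m) (free_rows m T)"
  shows "X3 (Suc m) (cons_col c T) = X3 m T + (if c (m - 1) \<noteq> None then 1 else 0)"
proof -
  let ?A = "{j \<in> {1..m - 2}. T (m - j - 1) j \<noteq> None}"
  \<comment> \<open>For \<open>m\<close> at most 1 the truncated \<open>m - 1\<close> is 0; the
    empty row 0 then makes the extra term vanish, as the third diagonal has no boxes.\<close>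
  have c0: "c 0 = None"
    using full_columns_D(1)[OF c, of 0] by (simp add: free_rows_def)
  have "{j \<in> {1..Suc m - 2}. cons_col c T (Suc m - j - 1) j \<noteq> None} =
    Suc ` ?A \<union> (if c (m - 1) \<noteq> None then {1} else {})" (is "?L = ?R")
  proof (intro equalityI subsetI)
    fix j assume j: "j \<in> ?L"
    show "j \<in> ?R"
    proof (cases "j = 1")
      case True
      then show ?thesis using j by (auto simp: cons_col_def)
    next
      case False
      then have "j - 1 \<in> ?A" "j = Suc (j - 1)"
        using j by (auto simp: cons_col_def)
      then show ?thesis by blast
    qed
  next
    fix j assume j: "j \<in> ?R"
    show "j \<in> ?L"
    proof (cases "j \<in> Suc ` ?A")
      case True
      then show ?thesis by (auto simp: cons_col_def)
    next
      case False
      then have "j = 1" "c (m - 1) \<noteq> None" using j by (auto split: if_splits)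
      moreover from this have "m - 1 \<noteq> 0" using c0 by metis
      ultimately show ?thesis by (auto simp: cons_col_def)
    qed
  qed
  moreover have "Suc ` ?A \<inter> {1} = {}" by auto
  ultimately show ?thesis
    unfolding X3_def by (auto simp: card_Un_disjoint card_image)
qed

lemma free_rows_cons_col:
  assumes T: "T \<in> ab_staircases m"
  shows "free_rows (Suc m) (cons_col c T) =
    {i \<in> insert (Suc m) (free_rows m T). c i \<noteq> Some Beta}" (is "?L = ?R")
proof (intro equalityI subsetI)
  fix i assume i: "i \<in> ?L"
  then have n: "cons_col c T i j \<noteq> Some Beta" for j by (auto simp: free_rows_def)
  have "T i j \<noteq> Some Beta" for j
    using n[of "Suc j"] ab_staircase_D(1)[OF T, of i j]
    by (cases "j = 0") (auto simp: cons_col_def in_stair_def)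
  then show "i \<in> ?R" using i n[of 1] by (auto simp: free_rows_def cons_col_def)
next
  fix i assume i: "i \<in> ?R"
  have "T (Suc m) j = None" for j
    using ab_staircase_D(1)[OF T, of "Suc m" j] by (auto simp: in_stair_def)
  then show "i \<in> ?L" using i by (auto simp: free_rows_def cons_col_def)
qed

text \<open>Here \<open>z\<close> is \<open>y\<close> on the third diagonal and 1 elsewhere, and \<open>w\<close> is the factor of the row of the
  box, due as long as the row stays free.\<close>

definition box_weight :: "'a::comm_ring_1 \<Rightarrow> 'a \<Rightarrow> 'a \<Rightarrow> 'a \<Rightarrow> sym option \<Rightarrow> 'a" where
  "box_weight a b z w s =
     (case s of None \<Rightarrow> w | Some Alpha \<Rightarrow> a * z * w | Some Beta \<Rightarrow> b * z)"

lemma prod_box_weight: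
  fixes a b :: "'a::comm_ring_1"
  assumes "finite I"
  shows "(\<Prod>i\<in>I. box_weight a b (z i) (w i) (c i)) =
    a ^ card {i \<in> I. c i = Some Alpha} * b ^ card {i \<in> I. c i = Some Beta} *
    (\<Prod>i\<in>{i \<in> I. c i \<noteq> None}. z i) * (\<Prod>i\<in>{i \<in> I. c i \<noteq> Some Beta}. w i)"
  using assms
proof (induction I rule: finite_induct)
  case (insert k I)
  have *: "{i \<in> insert k I. P i} = (if P k then insert k {i \<in> I. P i} else {i \<in> I. P i})" for P
    by auto
  show ?case
    unfolding * using insert
    by (cases "c k" rule: option.exhaust; cases "the (c k)") (simp_all add: box_weight_def)
qed simp

section \<open>Generating functions with weighted free rows, and their recurrence in the
  size\<close>

definition row_weight :: "nat \<Rightarrow> 'a \<Rightarrow> 'a \<Rightarrow> 'a \<Rightarrow> nat \<Rightarrow> 'a" where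
  "row_weight m x u v i = (if i = m then u else if Suc i = m then v else x)"

definition stair_gf :: "'a::comm_ring_1 \<Rightarrow> 'a \<Rightarrow> 'a \<Rightarrow> nat \<Rightarrow> 'a \<Rightarrow> 'a \<Rightarrow> 'a \<Rightarrow> 'a" where
  "stair_gf a b y m x u v = (\<Sum>T\<in>ab_staircases m.
     a ^ num_sym m Alpha T * b ^ num_sym m Beta T * y ^ X3 m T *
     (\<Prod>i\<in>free_rows m T. row_weight m x u v i))"

text \<open>The sum telescopes: an \<alpha> in row \<open>i\<close> leaves a factor \<open>x\<close>
  for each row above and \<open>x + b * z j\<close> for each row \<open>j\<close> below, and
  \<open>b * z i\<close> is the difference of \<open>x + b * z i\<close> and \<open>x\<close>. The
  factor \<open>b\<close> on the left avoids a division.\<close>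

lemma sum_columns_on_const_weight:
  fixes a b x :: "'a::comm_ring_1"
  assumes "finite I"
  shows "b * (\<Sum>c\<in>columns_on I. \<Prod>i\<in>I. box_weight a b (z i) x (c i)) =
    (a * x + b) * (\<Prod>i\<in>I. x + b * z i) - a * x * x ^ card I"
  using assms
proof (induction I rule: finite_linorder_max_induct)
  case empty
  have "columns_on {} = {\<lambda>_. None}" by (auto simp: columns_on_def)
  then show ?case by simp
next
  case (insert k I)
  then have "k \<notin> I" by blast
  let ?S = "\<Sum>c\<in>columns_on I. \<Prod>i\<in>I. box_weight a b (z i) x (c i)"
  have "b * (\<Sum>c\<in>columns_on (insert k I). \<Prod>i\<in>insert k I. box_weight a b (z i) x (c i)) =
    (x + b * z k) * (b * ?S) + a * b * z k * x * x ^ card I"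
    using insert by (subst sum_columns_on_insert) (auto simp: box_weight_def algebra_simps)
  also have "\<dots> = (a * x + b) * (\<Prod>i\<in>insert k I. x + b * z i) - a * x * x ^ card (insert k I)"
    unfolding insert.IH using insert.hyps \<open>k \<notin> I\<close> by (simp add: algebra_simps)
  finally show ?case .
qed

text \<open>Three rows are special: \<open>Suc m\<close> with factor \<open>u\<close>,
  \<open>m\<close> with factor \<open>v\<close>, and \<open>m - 1\<close>, whose box is on the third
  diagonal. Every product on the right consists of row weights for size \<open>m\<close>, so it can
  be summed over tableaux. The final difference detects whether row \<open>m\<close> is free: it is
  the product over the other rows if so, and 0 otherwise.\<close>

lemma sum_full_columns_weight:
  fixes a b x :: "'a::comm_ring_1"
  assumes I: "I \<subseteq> {1..m}"
  shows "(\<Sum>c\<in>full_columns (Suc m) I. \<Prod>i\<in>insert (Suc m) I.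
      box_weight a b (if Suc i = m then y else 1) (row_weight (Suc m) x u v i) (c i)) =
    (a * x + b) * (\<Prod>i\<in>I. row_weight m (x + b) (v + b) (x + y * b) i) +
    a * (u - x) * (\<Prod>i\<in>I. row_weight m x v x i) +
    a * b * (v - x) * ((\<Prod>i\<in>I. row_weight m x 1 x i) - (\<Prod>i\<in>I. row_weight m x 0 x i))"
proof -
  \<comment> \<open>Row \<open>m\<close> has the factor \<open>v\<close> instead of
    \<open>x\<close>, so it is set aside before the constant-weight formula is applied.\<close>
  define J where "J = I - {m}"
  define f where "f = (\<lambda>i. box_weight a b (if Suc i = m then y else 1) (row_weight (Suc m) x u v i))"
  define R where "R = (\<Prod>i\<in>J. row_weight m (x + b) (v + b) (x + y * b) i)"
  define S where "S I = (\<Sum>c\<in>columns_on I. \<Prod>i\<in>I. f i (c i))" for I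
  have fin: "finite I" "finite J" using finite_subset[OF I] by (simp_all add: J_def)
  have J: "i < m" if "i \<in> J" for i using that I by (force simp: J_def)
  have J': "m \<notin> J" "Suc m \<notin> J" using J by force+
  have "b * S J = b * (\<Sum>c\<in>columns_on J. \<Prod>i\<in>J. box_weight a b (if Suc i = m then y else 1) x (c i))"
    unfolding S_def f_def using J'
    by (intro arg_cong2[where f = "(*)"] sum.cong prod.cong refl) (auto simp: row_weight_def)
  also have "\<dots> = (a * x + b) * R - a * x * x ^ card J"
    unfolding sum_columns_on_const_weight[OF fin(2)] R_def using J'
    by (intro arg_cong2[where f = "(-)"] arg_cong2[where f = "(*)"] prod.cong refl)
       (auto simp: row_weight_def)
  finally have SJ: "b * S J = (a * x + b) * R - a * x * x ^ card J" .
  have PJ: "(\<Prod>i\<in>J. row_weight m x w x i) = x ^ card J" for w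
    using J' by (subst prod.cong[OF refl, of _ _ "\<lambda>_. x"]) (auto simp: row_weight_def)
  have NJ: "(\<Prod>i\<in>J. f i None) = x ^ card J"
    using J' by (subst prod.cong[OF refl, of _ _ "\<lambda>_. x"]) (auto simp: row_weight_def f_def box_weight_def)
  have f1: "f (Suc m) (Some Alpha) = a * u" "f (Suc m) (Some Beta) = b"
    by (auto simp: f_def box_weight_def row_weight_def)
  have fm: "f m None = v" "f m (Some Alpha) = a * v" "f m (Some Beta) = b"
    by (auto simp: f_def box_weight_def row_weight_def)
  have less: "i < Suc m" if "i \<in> I" for i using that I by force
  have "(\<Sum>c\<in>full_columns (Suc m) I. \<Prod>i\<in>insert (Suc m) I. f i (c i)) =
    a * u * (\<Prod>i\<in>I. f i None) + b * S I"
    using sum_full_columns[OF fin(1) less, of f] by (simp add: f1 S_def)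
  also have "\<dots> = (a * x + b) * (\<Prod>i\<in>I. row_weight m (x + b) (v + b) (x + y * b) i) +
    a * (u - x) * (\<Prod>i\<in>I. row_weight m x v x i) +
    a * b * (v - x) * ((\<Prod>i\<in>I. row_weight m x 1 x i) - (\<Prod>i\<in>I. row_weight m x 0 x i))"
  proof (cases "m \<in> I")
    case True
    then have IJ: "I = insert m J" and mJ: "m \<notin> J" by (auto simp: J_def)
    have P: "(\<Prod>i\<in>I. h i) = h m * (\<Prod>i\<in>J. h i)" for h :: "nat \<Rightarrow> 'a"
      using IJ mJ fin by simp
    have "b * S I = (v + b) * (b * S J) + b * (a * v) * x ^ card J"
      unfolding S_def IJ using sum_columns_on_insert[OF fin(2) J, of f]
      by (simp add: fm NJ algebra_simps)
    then show ?thesis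
      unfolding P NJ PJ R_def[symmetric] SJ fm
      by (simp add: row_weight_def algebra_simps)
  next
    case False
    then have "I = J" by (auto simp: J_def)
    then show ?thesis
      using SJ NJ PJ by (simp add: R_def algebra_simps)
  qed
  finally show ?thesis by (simp only: f_def)
qed

lemma stair_gf_summand_cons_col:
  fixes a b x :: "'a::comm_ring_1"
  assumes T: "T \<in> ab_staircases m" and c: "c \<in> full_columns (Suc m) (free_rows m T)"
  defines "T' \<equiv> cons_col c T"
  shows "a ^ num_sym (Suc m) Alpha T' * b ^ num_sym (Suc m) Beta T' * y ^ X3 (Suc m) T' *
      (\<Prod>i\<in>free_rows (Suc m) T'. row_weight (Suc m) x u v i) =
    a ^ num_sym m Alpha T * b ^ num_sym m Beta T * y ^ X3 m T *
      (\<Prod>i\<in>insert (Suc m) (free_rows m T).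
        box_weight a b (if Suc i = m then y else 1) (row_weight (Suc m) x u v i) (c i))"
proof -
  let ?I = "insert (Suc m) (free_rows m T)"
  have "(\<Prod>i\<in>{i \<in> ?I. c i \<noteq> None}. if Suc i = m then y else 1) =
    (\<Prod>i\<in>{i \<in> ?I. c i \<noteq> None} \<inter> {i. Suc i = m}. y)"
    by (subst prod.If_cases) auto
  \<comment> \<open>For \<open>m = 0\<close> and \<open>m = 1\<close> both sides are empty, since
    the column is empty in row 0.\<close>
  also have "{i \<in> ?I. c i \<noteq> None} \<inter> {i. Suc i = m} = (if c (m - 1) \<noteq> None then {m - 1} else {})"
    using full_columns_D(1)[OF c, of "m - 1"] full_columns_D(1)[OF c, of 0] free_rows_subset[of m T]
    by (cases m) auto
  finally have "(\<Prod>i\<in>{i \<in> ?I. c i \<noteq> None}. if Suc i = m then y else 1) =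
    y ^ (if c (m - 1) \<noteq> None then 1 else 0)" by simp
  then show ?thesis
    unfolding T'_def num_sym_cons_col[OF T c] X3_cons_col[OF c] free_rows_cons_col[OF T]
    by (subst prod_box_weight) (simp_all only: finite_insert finite_free_rows power_add mult_ac)
qed

lemma stair_gf_Suc:
  fixes a b x :: "'a::comm_ring_1"
  shows "stair_gf a b y (Suc m) x u v =
    (a * x + b) * stair_gf a b y m (x + b) (v + b) (x + y * b) +
    a * (u - x) * stair_gf a b y m x v x +
    a * b * (v - x) * (stair_gf a b y m x 1 x - stair_gf a b y m x 0 x)"
proof -
  define t where "t T = a ^ num_sym m Alpha T * b ^ num_sym m Beta T * y ^ X3 m T" for T
  define W where "W x u v T = (\<Prod>i\<in>free_rows m T. row_weight m x u v i)" for x u v :: 'a and T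
  have gf: "stair_gf a b y m x u v = (\<Sum>T\<in>ab_staircases m. t T * W x u v T)" for x u v
    by (simp add: stair_gf_def t_def W_def)
  have "stair_gf a b y (Suc m) x u v =
    (\<Sum>(T, c)\<in>(SIGMA T:ab_staircases m. full_columns (Suc m) (free_rows m T)).
      t T * (\<Prod>i\<in>insert (Suc m) (free_rows m T).
        box_weight a b (if Suc i = m then y else 1) (row_weight (Suc m) x u v i) (c i)))"
    unfolding stair_gf_def ab_staircases_Suc sum.reindex[OF inj_on_cons_col] t_def
    by (intro sum.cong refl) (auto simp: stair_gf_summand_cons_col)
  also have "\<dots> = (\<Sum>T\<in>ab_staircases m. t T * ((a * x + b) * W (x + b) (v + b) (x + y * b) T +
      a * (u - x) * W x v x T + a * b * (v - x) * (W x 1 x T - W x 0 x T)))"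
    unfolding W_def sum_full_columns_weight[OF free_rows_subset, symmetric]
    by (subst sum.Sigma[symmetric]) (auto simp: finite_full_columns sum_distrib_left)
  also have "\<dots> = (a * x + b) * stair_gf a b y m (x + b) (v + b) (x + y * b) +
    a * (u - x) * stair_gf a b y m x v x +
    a * b * (v - x) * (stair_gf a b y m x 1 x - stair_gf a b y m x 0 x)"
    unfolding gf by (simp add: algebra_simps sum.distrib sum_subtractf sum_distrib_left)
  finally show ?thesis .
qed

lemma stair_gf_0: "stair_gf a b y 0 x u v = 1"
  by (simp add: stair_gf_def ab_staircases_0 num_sym_def X3_def free_rows_def)

section \<open>Elimination of the auxiliary row weights\<close>

text \<open>Row \<open>Suc m\<close> is free exactly when its box carries an \<alpha>; then the rest
  of the first column is empty and the remaining tableau is arbitrary. This explains the coefficient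
  of \<open>u\<close>.\<close>

lemma stair_gf_Suc_linear:
  fixes a b x :: "'a::comm_ring_1"
  shows "stair_gf a b y (Suc m) x u' v = stair_gf a b y (Suc m) x u v + a * (u' - u) * stair_gf a b y m x v x"
  by (simp add: stair_gf_Suc algebra_simps)

definition diag_gf :: "'a::comm_ring_1 \<Rightarrow> 'a \<Rightarrow> 'a \<Rightarrow> nat \<Rightarrow> 'a \<Rightarrow> 'a" where
  "diag_gf a b y m x = stair_gf a b y m x x x"

text \<open>The difference between bottom weights 1 and 0 is the coefficient of the bottom weight,
  which is \<open>a\<close> times \<open>diag_gf\<close> when all other rows have weight
  \<open>x\<close>.\<close>

lemma stair_gf_Suc_Suc:
  fixes a b x :: "'a::comm_ring_1"
  shows "stair_gf a b y (Suc (Suc m)) x u v =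
    (a * x + b) * stair_gf a b y (Suc m) (x + b) (v + b) (x + y * b) +
    a * (u - x) * stair_gf a b y (Suc m) x v x +
    a\<^sup>2 * b * (v - x) * diag_gf a b y m x"
  unfolding stair_gf_Suc[of a b y "Suc m"] stair_gf_Suc_linear[of a b y m x 1 x 0] diag_gf_def
  by (simp add: algebra_simps power2_eq_square)

lemma diag_gf_Suc:
  fixes a b x :: "'a::comm_ring_1"
  shows "diag_gf a b y (Suc m) x = (a * x + b) * stair_gf a b y m (x + b) (x + b) (x + b + (y - 1) * b)"
  unfolding diag_gf_def stair_gf_Suc by (simp add: algebra_simps)

text \<open>Since \<open>x + y * b\<close> is \<open>x + b + e\<close>, the auxiliary weights are
  perturbations by \<open>e\<close>. Affinity in the bottom weight, used twice, removes the
  perturbation there; the one left in the second weight is exactly what \<open>diag_gf_Suc\<close>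
  produces, so it is absorbed into \<open>A (m + 3) (x + b)\<close>.\<close>

lemma diag_gf_rec:
  fixes a b x y :: "'a::comm_ring_1"
  defines "A \<equiv> diag_gf a b y" and "e \<equiv> (y - 1) * b"
  shows "A (m + 4) x = (a * x + b) * (A (m + 3) (x + b) +
     (a * (x + b) + b) * (a * e * A (m + 1) (x + 2 * b) + (a * e)\<^sup>2 * A m (x + 2 * b)) +
     a\<^sup>2 * b * e * A (m + 1) (x + b))"
proof -
  let ?F = "stair_gf a b y"
  let ?x = "x + b" and ?z = "x + b + b"
  have C: "?F (Suc (Suc m)) ?z (?z + e) (?z + e) =
    ?F (Suc (Suc m)) ?z ?z (?z + e) + a * e * (A (Suc m) ?z + a * e * A m ?z)"
    unfolding stair_gf_Suc_linear[of a b y "Suc m" ?z "?z + e" "?z + e" ?z]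
      stair_gf_Suc_linear[of a b y m ?z "?z + e" ?z ?z] A_def diag_gf_def
    by (simp add: algebra_simps)
  have "?F (Suc (Suc (Suc m))) ?x ?x (?x + e) =
    (a * ?x + b) * ?F (Suc (Suc m)) ?z (?z + e) (?z + e) + a\<^sup>2 * b * e * A (Suc m) ?x"
    unfolding stair_gf_Suc_Suc A_def by (simp add: e_def algebra_simps)
  moreover have "A (Suc (Suc (Suc m))) ?x = (a * ?x + b) * ?F (Suc (Suc m)) ?z ?z (?z + e)"
    unfolding A_def diag_gf_Suc e_def by simp
  moreover have "A (Suc (Suc (Suc (Suc m)))) x = (a * x + b) * ?F (Suc (Suc (Suc m))) ?x ?x (?x + e)"
    unfolding A_def diag_gf_Suc e_def by simp
  ultimately show ?thesis
    unfolding C by (simp add: algebra_simps numeral_eq_Suc power2_eq_square)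
qed

text \<open>Initial values for the recurrence of order four; size 3 has its form without the summand
  in \<open>(a * e)\<^sup>2\<close>.\<close>

lemma diag_gf_small:
  fixes a b x y :: "'a::comm_ring_1"
  defines "A \<equiv> diag_gf a b y" and "e \<equiv> (y - 1) * b"
  shows "A 0 x = 1" "A 1 x = a * x + b" "A 2 x = (a * x + b) * (a * (x + b) + b)"
    "A 3 x = (a * x + b) * (A 2 (x + b) + (a * (x + b) + b) * (a * e) + a\<^sup>2 * b * e)"
  unfolding A_def e_def diag_gf_def
  by (simp_all add: stair_gf_0 stair_gf_Suc numeral_eq_Suc algebra_simps power2_eq_square)


section \<open>Normalisation by the solution for y = 1\<close>

definition norm_const :: "'a::field \<Rightarrow> 'a \<Rightarrow> nat \<Rightarrow> nat \<Rightarrow> 'a" where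
  "norm_const a b s k = (a * b) ^ s * pochhammer (1 / a + 1 / b + of_nat k) s"

text \<open>This strips the first factor of the Pochhammer product and shifts \<open>k\<close>;
  \<open>norm_const_rec'\<close> strips the last one and keeps \<open>k\<close>.\<close>

lemma norm_const_rec:
  "norm_const a b (Suc s) k = a * b * (1 / a + 1 / b + of_nat k) * norm_const a b s (Suc k)"
  by (simp add: norm_const_def pochhammer_rec add_ac)

lemma norm_const_rec':
  "norm_const a b (Suc s) k = a * b * (1 / a + 1 / b + of_nat (s + k)) * norm_const a b s k"
  by (simp add: norm_const_def pochhammer_Suc add_ac)

text \<open>For \<open>y = 1\<close> the perturbation vanishes, and a step only replaces
  \<open>x\<close> by \<open>x + b\<close>, that is \<open>k\<close> by
  \<open>k + 1\<close>.\<close>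

lemma diag_gf_one:
  fixes a b :: "'a::field"
  assumes "a \<noteq> 0" "b \<noteq> 0"
  shows "diag_gf a b 1 s (1 + of_nat k * b) = norm_const a b s k"
proof (induction s arbitrary: k)
  case 0
  then show ?case by (simp add: diag_gf_small norm_const_def)
next
  case (Suc s)
  have "diag_gf a b 1 (Suc s) (1 + of_nat k * b) =
    (a * (1 + of_nat k * b) + b) * diag_gf a b 1 s (1 + of_nat (Suc k) * b)"
    unfolding diag_gf_Suc by (simp add: diag_gf_def algebra_simps)
  also have "a * (1 + of_nat k * b) + b = a * b * (1 / a + 1 / b + of_nat k)"
    using assms by (simp add: field_simps)
  finally show ?case unfolding Suc.IH norm_const_rec .
qed

definition norm_gf :: "'a::field \<Rightarrow> 'a \<Rightarrow> 'a \<Rightarrow> nat \<Rightarrow> nat \<Rightarrow> 'a" where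
  "norm_gf a b y s k = diag_gf a b y s (1 + of_nat k * b) / norm_const a b s k"

lemma norm_gf_rec:
  fixes a b y :: "'a::field"
  assumes ab: "a \<noteq> 0" "b \<noteq> 0" and nz: "\<And>j. 1 / a + 1 / b + of_nat j \<noteq> 0"
  defines "c \<equiv> 1 / a + 1 / b" and "g \<equiv> norm_gf a b y"
  shows "g 0 k = 1" "g 1 k = 1" "g 2 k = 1"
    "g 3 k = 1 + (y - 1) / (c + of_nat (k + 2)) + (y - 1) / ((c + of_nat (k + 2)) * (c + of_nat (k + 1)))"
    "g (s + 4) k = g (s + 3) (k + 1) + (y - 1) / (c + of_nat (s + k + 3)) * g (s + 1) (k + 2) +
      ((y - 1)\<^sup>2 * g s (k + 2) + (y - 1) * g (s + 1) (k + 1)) /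
        ((c + of_nat (s + k + 3)) * (c + of_nat (s + k + 2)))"
proof -
  \<comment> \<open>These are the factors of the Pochhammer product: \<open>p s k\<close> is the
    product of \<open>q k\<close> up to \<open>q (k + s - 1)\<close>. At
    \<open>x = 1 + k * b\<close> the factor \<open>a * x + b\<close> of the recurrence equals
    \<open>q k\<close>.\<close>
  define q where "q j = a * b * (c + of_nat j)" for j
  define p where "p = norm_const a b"
  define A where "A s k = diag_gf a b y s (1 + of_nat k * b)" for s k
  have q0: "q j \<noteq> 0" for j using ab nz by (simp add: q_def c_def)
  have p0: "p 0 k = 1" for k by (simp add: p_def norm_const_def)
  have p1: "p (Suc s) k = q k * p s (Suc k)" for s k
    using norm_const_rec[of a b s k] by (simp add: p_def q_def c_def)
  have p2: "p (Suc s) k = q (s + k) * p s k" for s k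
    using norm_const_rec'[of a b s k] by (simp add: p_def q_def c_def)
  have pnz: "p s k \<noteq> 0" for s k by (induction s arbitrary: k) (simp_all add: p0 p1 q0)
  have g: "g s k = A s k / p s k" for s k by (simp add: g_def norm_gf_def A_def p_def)
  have x: "a * (1 + of_nat k * b) + b = q k" for k
    using ab by (simp add: q_def c_def field_simps)
  have x1: "1 + of_nat k * b + b = 1 + of_nat (k + 1) * b"
    "1 + of_nat k * b + 2 * b = 1 + of_nat (k + 2) * b" for k by (simp_all add: algebra_simps)
  have A012: "A 0 k = 1" "A 1 k = q k" "A 2 k = q k * q (k + 1)" for k
    unfolding A_def by (simp_all only: diag_gf_small x1 x)
  have p012: "p 0 k = 1" "p 1 k = q k" "p 2 k = q k * q (k + 1)" for k
    by (simp_all add: numeral_2_eq_2 p1 p0)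
  show "g 0 k = 1" "g 1 k = 1" "g 2 k = 1" for k
    using q0 p012 unfolding g A012 by simp_all
  have A3: "A 3 k = q k * (A 2 (k + 1) + q (k + 1) * (a * ((y - 1) * b)) + a\<^sup>2 * b * ((y - 1) * b))"
    unfolding A_def by (simp only: diag_gf_small(4) x1 x)
  have p3: "p 3 k = q k * (q (k + 1) * q (k + 2))"
    by (simp add: numeral_3_eq_3 p1 p0)
  have "g 3 k = A 2 (k + 1) / (q (k + 1) * q (k + 2)) + a * b * (y - 1) / q (k + 2) +
      (a * b)\<^sup>2 * (y - 1) / (q (k + 1) * q (k + 2))"
    using q0 unfolding g A3 p3 by (simp add: field_simps power2_eq_square)
  also have "\<dots> = 1 + (y - 1) / (c + of_nat (k + 2)) + (y - 1) / ((c + of_nat (k + 2)) * (c + of_nat (k + 1)))"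
    using q0[of "k + 1"] q0[of "k + 2"] ab unfolding A012
    by (simp add: q_def power2_eq_square mult_ac)
  finally show "g 3 k = \<dots>" .
  define \<eta> where "\<eta> = y - 1"
  have "A (s + 4) k = q k * (A (s + 3) (k + 1) + q (k + 1) *
      (a * (\<eta> * b) * A (s + 1) (k + 2) + (a * (\<eta> * b))\<^sup>2 * A s (k + 2)) +
      a\<^sup>2 * b * (\<eta> * b) * A (s + 1) (k + 1))"
    unfolding A_def \<eta>_def by (simp only: diag_gf_rec x1 x)
  moreover have "p (s + 4) k = q k * p (s + 3) (k + 1)"
    using p1[of "s + 3" k] by (simp add: eval_nat_numeral)
  ultimately have "g (s + 4) k = (A (s + 3) (k + 1) + q (k + 1) *
      (a * (\<eta> * b) * A (s + 1) (k + 2) + (a * (\<eta> * b))\<^sup>2 * A s (k + 2)) +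
      a\<^sup>2 * b * (\<eta> * b) * A (s + 1) (k + 1)) / p (s + 3) (k + 1)"
    using q0 by (simp add: g)
  also have "\<dots> = g (s + 3) (k + 1) +
     q (k + 1) * (a * b * \<eta>) * A (s + 1) (k + 2) / p (s + 3) (k + 1) +
     (q (k + 1) * (a * b)\<^sup>2 * \<eta>\<^sup>2 * A s (k + 2) / p (s + 3) (k + 1) +
      (a * b)\<^sup>2 * \<eta> * A (s + 1) (k + 1) / p (s + 3) (k + 1))"
    unfolding g by (simp add: add_divide_distrib algebra_simps power2_eq_square)
  \<comment> \<open>In each summand \<open>p (s + 3) (k + 1)\<close> is stripped from either end
    down to the index of the \<open>A\<close> concerned. A stripped bottom factor cancels
    \<open>q (k + 1)\<close>; the top factors become the denominators.\<close>
  also have "q (k + 1) * (a * b * \<eta>) * A (s + 1) (k + 2) / p (s + 3) (k + 1) =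
    \<eta> / (c + of_nat (s + k + 3)) * g (s + 1) (k + 2)"
  proof -
    have "p (s + 3) (k + 1) = q (k + 1) * (q (s + k + 3) * p (s + 1) (k + 2))"
      using p1[of "s + 2" "k + 1"] p2[of "s + 1" "k + 2"] by (simp add: eval_nat_numeral)
    then show ?thesis using q0 ab by (simp add: g) (simp add: q_def)
  qed
  also have "q (k + 1) * (a * b)\<^sup>2 * \<eta>\<^sup>2 * A s (k + 2) / p (s + 3) (k + 1) =
    \<eta>\<^sup>2 * g s (k + 2) / ((c + of_nat (s + k + 3)) * (c + of_nat (s + k + 2)))"
  proof -
    have "p (s + 3) (k + 1) = q (k + 1) * (q (s + k + 3) * (q (s + k + 2) * p s (k + 2)))"
      using p1[of "s + 2" "k + 1"] p2[of "s + 1" "k + 2"] p2[of s "k + 2"] by (simp add: eval_nat_numeral)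
    then show ?thesis using q0 ab by (simp add: g) (simp add: q_def power2_eq_square mult_ac)
  qed
  also have "(a * b)\<^sup>2 * \<eta> * A (s + 1) (k + 1) / p (s + 3) (k + 1) =
    \<eta> * g (s + 1) (k + 1) / ((c + of_nat (s + k + 3)) * (c + of_nat (s + k + 2)))"
  proof -
    have "p (s + 3) (k + 1) = q (s + k + 3) * (q (s + k + 2) * p (s + 1) (k + 1))"
      using p2[of "s + 2" "k + 1"] p2[of "s + 1" "k + 1"] by (simp add: eval_nat_numeral)
    then show ?thesis using q0 ab by (simp add: g) (simp add: q_def power2_eq_square mult_ac)
  qed
  finally show "g (s + 4) k = g (s + 3) (k + 1) + (y - 1) / (c + of_nat (s + k + 3)) * g (s + 1) (k + 2) +
      ((y - 1)\<^sup>2 * g s (k + 2) + (y - 1) * g (s + 1) (k + 1)) /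
        ((c + of_nat (s + k + 3)) * (c + of_nat (s + k + 2)))"
    by (simp only: \<eta>_def add_divide_distrib)
qed

section \<open>The limit of the recurrence\<close>

text \<open>The recurrence started at \<open>(n, 0)\<close> never leaves the region \<open>n \<le> 3 k + s\<close>, and there
  \<open>s + k \<ge> n / 3\<close>, so that all error terms are comparable to powers of \<open>1 / n\<close>.\<close>

lemma discrete_gronwall:
  fixes d :: "nat \<Rightarrow> nat \<Rightarrow> real"
  assumes nonneg: "L \<ge> 0" "Q \<ge> 0" "B \<ge> 0"
    and base: "\<And>s k. s \<le> 3 \<Longrightarrow> s + k \<ge> 1 \<Longrightarrow> d s k \<le> B / real (s + k)"
    and step: "\<And>s k. d (s + 4) k \<le> d (s + 3) (k + 1) +
      L / real (s + k + 4) * (d (s + 1) (k + 2) + d s (k + 2) + d (s + 1) (k + 1)) +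
      Q / (real (s + k + 4))\<^sup>2"
    and n: "n \<ge> 1"
  shows "n \<le> 3 * k + s \<Longrightarrow> d s k \<le> (9 * Q + 3 * B) / n * (1 + (9 * L + 1) / n) ^ s"
proof (induction s arbitrary: k rule: less_induct)
  case (less s)
  \<comment> \<open>The bound \<open>s + k \<ge> n / 3\<close> turns \<open>B / (s + k)\<close> into
    \<open>3 * B / n\<close>, the coefficient \<open>L / (s + k)\<close> on three terms into
    \<open>9 * L / n\<close>, and the inhomogeneity into \<open>9 * Q / n\<^sup>2\<close>. The
    latter is at most \<open>E / n\<close>, which accounts for the extra 1 in
    \<open>q\<close>.\<close>
  define E where "E = (9 * Q + 3 * B) / real n"
  define q where "q = 1 + (9 * L + 1) / real n"
  have E: "E \<ge> 0" using nonneg by (simp add: E_def)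
  have q: "q \<ge> 1" using nonneg by (simp add: q_def)
  have N: "real n / 3 \<le> real (s + k)" "s + k \<ge> 1" "real n > 0" using less.prems n by linarith+
  show ?case
  proof (cases "s \<le> 3")
    case True
    have "d s k \<le> B / real (s + k)" using base[OF True N(2)] .
    also have "\<dots> \<le> B / (real n / 3)"
      using N n nonneg by (intro divide_left_mono) auto
    also have "\<dots> \<le> E" using nonneg n by (simp add: E_def divide_simps)
    also have "\<dots> \<le> E * q ^ s" using mult_left_mono[OF one_le_power[OF q] E] by simp
    finally show ?thesis by (simp add: E_def q_def)
  next
    case False
    define r where "r = s - 4"
    have s: "s = r + 4" using False by (simp add: r_def)
    define M where "M = E * q ^ (r + 3)"
    have M: "E \<le> M" using mult_left_mono[OF one_le_power[OF q, of "r + 3"] E] by (simp add: M_def)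
    have IH: "d j l \<le> M" if "j \<le> r + 3" "n \<le> 3 * l + j" for j l
    proof -
      have "d j l \<le> E * q ^ j"
        using less.IH[of j l] that s by (simp add: E_def q_def)
      also have "\<dots> \<le> M"
        unfolding M_def using that q E by (intro mult_left_mono power_increasing) auto
      finally show ?thesis .
    qed
    \<comment> \<open>None of the four moves decreases \<open>3 * k + s\<close>; the move to
      \<open>(r + 1, k + 1)\<close> preserves it exactly.\<close>
    have D: "d (r + 3) (k + 1) \<le> M" "d (r + 1) (k + 2) \<le> M" "d r (k + 2) \<le> M" "d (r + 1) (k + 1) \<le> M"
      using less.prems s by (auto intro!: IH)
    have "L / real (r + k + 4) * (d (r + 1) (k + 2) + d r (k + 2) + d (r + 1) (k + 1)) \<le>
      L / real (r + k + 4) * (3 * M)"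
      using D nonneg by (intro mult_left_mono) auto
    also have "\<dots> \<le> L / (real n / 3) * (3 * M)"
      using N nonneg s M E by (intro mult_right_mono divide_left_mono) auto
    finally have 1: "L / real (r + k + 4) * (d (r + 1) (k + 2) + d r (k + 2) + d (r + 1) (k + 1)) \<le>
      9 * L / n * M" by simp
    have "Q / (real (r + k + 4))\<^sup>2 \<le> Q / (real n / 3)\<^sup>2"
      using N nonneg s by (intro divide_left_mono power_mono mult_pos_pos) auto
    also have "\<dots> = 9 * Q / n / n" by (simp add: power2_eq_square)
    also have "\<dots> \<le> E / n" unfolding E_def using nonneg by (intro divide_right_mono) auto
    also have "\<dots> \<le> M / n" using M by (intro divide_right_mono) auto
    finally have 2: "Q / (real (r + k + 4))\<^sup>2 \<le> M / n" .
    have "d s k \<le> M + 9 * L / n * M + M / n"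
      using step[of r k] D(1) 1 2 s by simp
    also have "\<dots> = E * q ^ s"
      unfolding s M_def by (simp add: q_def add_divide_distrib algebra_simps eval_nat_numeral)
    finally show ?thesis by (simp add: E_def q_def)
  qed
qed

section \<open>The exponential profile and its defect in the recurrence\<close>

lemma norm_exp_minus_one_le:
  fixes z :: complex
  shows "norm (exp z - 1) \<le> exp (norm z) * norm z"
  using Taylor_exp_field[of z 0] by simp

lemma norm_exp_minus_linear_le:
  fixes z :: complex
  shows "norm (exp z - 1 - z) \<le> exp (norm z) * (norm z)\<^sup>2"
  using Taylor_exp_field[of z 1] by (simp add: power2_eq_square diff_diff_eq)

text \<open>Suggested by the leading terms: the move from \<open>(s - 1, k + 1)\<close> to
  \<open>(s, k)\<close> keeps \<open>N = s + k\<close> and multiplies by about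
  \<open>1 + \<eta> / N\<close>; \<open>s\<close> such moves give the exponential.\<close>

definition exp_profile :: "complex \<Rightarrow> nat \<Rightarrow> nat \<Rightarrow> complex" where
  "exp_profile \<eta> s k = exp (\<eta> * of_real (real s / real (s + k)))"

lemma norm_exp_profile_le: "norm (exp_profile \<eta> s k) \<le> exp (norm \<eta>)"
proof -
  define r where "r = real s / real (s + k)"
  have "0 \<le> r" "r \<le> 1" by (auto simp: r_def divide_simps)
  then have "norm (\<eta> * of_real r) \<le> norm \<eta>" by (simp add: norm_mult mult_left_le)
  then show ?thesis
    unfolding exp_profile_def r_def[symmetric] by (intro order_trans[OF norm_exp]) simp
qed

text \<open>With \<open>N = s + k + 4\<close> the defect splits into four errors of order
  \<open>1 / N\<^sup>2\<close>: the Taylor remainder of \<open>exp (\<eta> / N)\<close>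
  (\<open>T1\<close>), the replacement of \<open>h3\<close> by \<open>h1\<close> (\<open>T2\<close>)
  and of \<open>1 / N\<close> by \<open>1 / m\<close> (\<open>T3\<close>), and the terms with two
  denominators (\<open>T4\<close>). \<open>Q\<close> adds up their constants.\<close>

lemma exp_profile_residual:
  fixes \<eta> :: complex and c :: real
  assumes c: "c > 0"
  shows "\<exists>Q\<ge>0. \<forall>s k. norm (exp_profile \<eta> (s + 4) k - exp_profile \<eta> (s + 3) (k + 1) -
      \<eta> / of_real (c + real (s + k) + 3) * exp_profile \<eta> (s + 1) (k + 2) -
      (\<eta>\<^sup>2 * exp_profile \<eta> s (k + 2) + \<eta> * exp_profile \<eta> (s + 1) (k + 1)) /
        of_real ((c + real (s + k) + 3) * (c + real (s + k) + 2))) \<le> Q / (real (s + k + 4))\<^sup>2"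
proof -
  define e where "e = norm \<eta>"
  define H where "H = exp e"
  have e: "e \<ge> 0" and H: "H \<ge> 1" by (auto simp: e_def H_def)
  note hH = norm_exp_profile_le[of \<eta>, folded e_def H_def]
  define Q where "Q = H\<^sup>2 * e\<^sup>2 + 4 * H\<^sup>2 * e\<^sup>2 + 2 * H * e * (c + 1) + 4 * (e\<^sup>2 + e) * H"
  have Q: "Q \<ge> 0" using e H c by (simp add: Q_def)
  have expH: "exp (norm z) \<le> H" if "norm z \<le> e" for z :: complex
    using that by (simp add: H_def)
  have "norm (exp_profile \<eta> (s + 4) k - exp_profile \<eta> (s + 3) (k + 1) -
      \<eta> / of_real (c + real (s + k) + 3) * exp_profile \<eta> (s + 1) (k + 2) -
      (\<eta>\<^sup>2 * exp_profile \<eta> s (k + 2) + \<eta> * exp_profile \<eta> (s + 1) (k + 1)) /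
        of_real ((c + real (s + k) + 3) * (c + real (s + k) + 2))) \<le> Q / (real (s + k + 4))\<^sup>2"
    for s k
  proof -
    define N where "N = real (s + k + 4)"
    have N: "N \<ge> 4" by (simp add: N_def)
    define h4 where "h4 = exp_profile \<eta> (s + 4) k"
    define h3 where "h3 = exp_profile \<eta> (s + 3) (k + 1)"
    define h1 where "h1 = exp_profile \<eta> (s + 1) (k + 2)"
    define h0 where "h0 = exp_profile \<eta> s (k + 2)"
    define h1' where "h1' = exp_profile \<eta> (s + 1) (k + 1)"
    define m where "m = c + N - 1"
    define m' where "m' = c + N - 2"
    have mm: "c + real (s + k) + 3 = m" "c + real (s + k) + 2 = m'"
      by (auto simp: m_def m'_def N_def)
    have mge: "m \<ge> N / 2" "m' \<ge> N / 2" "m > 0" "m' > 0" using N c by (auto simp: m_def m'_def)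
    define z where "z = \<eta> / of_real N"
    have nz: "norm z = e / N" using N by (simp add: z_def e_def norm_divide)
    have nze: "norm z \<le> e" using N e mult_left_mono[of 1 N e] by (simp add: nz divide_simps)
    \<comment> \<open>Both points have the same coordinate sum \<open>N\<close>, so the exponents
      differ by exactly \<open>z\<close>.\<close>
    have "real (s + 4) / real (s + 4 + k) = real (s + 3) / real (s + 3 + (k + 1)) + 1 / N"
      by (simp add: N_def add_divide_distrib[symmetric] add_ac)
    moreover have "\<eta> * of_real (1 / N) = z" by (simp add: z_def)
    ultimately have h43: "h4 = h3 * exp z"
      unfolding h4_def h3_def exp_profile_def by (simp only: of_real_add distrib_left exp_add)
    have "norm (h4 - h3 - z * h3) = norm h3 * norm (exp z - 1 - z)"
      unfolding norm_mult[symmetric] h43 by (simp add: algebra_simps)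
    also have "\<dots> \<le> H * (H * (e / N)\<^sup>2)"
      using hH[of "s + 3" "k + 1"] norm_exp_minus_linear_le[of z] expH[OF nze] H
      by (intro mult_mono order_trans[OF norm_exp_minus_linear_le]) (auto simp: h3_def nz)
    finally have T1: "norm (h4 - h3 - z * h3) \<le> H\<^sup>2 * e\<^sup>2 / N\<^sup>2"
      by (simp add: power2_eq_square)
    \<comment> \<open>The point of \<open>h1\<close> has coordinate sum \<open>N - 1\<close>, so the
      two ratios differ by more than their numerators show, but still by order
      \<open>1 / N\<close>.\<close>
    define \<delta> where "\<delta> = (real s + 3) / N - (real s + 1) / (N - 1)"
    have \<delta>eq: "\<delta> = (2 * N - real s - 3) / (N * (N - 1))"
      using N by (simp add: \<delta>_def divide_simps) (simp add: algebra_simps)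
    have \<delta>0: "\<delta> \<ge> 0" unfolding \<delta>eq using N by (intro divide_nonneg_pos) (auto simp: N_def)
    have "\<delta> \<le> 2 * N / (N * (N - 1))" unfolding \<delta>eq using N by (intro divide_right_mono) auto
    also have "\<dots> \<le> 4 / N" using N by (simp add: divide_simps)
    finally have \<delta>4: "\<delta> \<le> 4 / N" .
    have \<delta>1: "\<delta> \<le> 1" using \<delta>4 N order_trans[of \<delta> "4 / N" 1] by simp
    have n\<delta>: "norm (\<eta> * of_real \<delta>) = e * \<delta>" using \<delta>0 by (simp add: norm_mult e_def)
    have n\<delta>e: "norm (\<eta> * of_real \<delta>) \<le> e" unfolding n\<delta> using \<delta>1 e by (simp add: mult_left_le)
    have h31: "h3 = h1 * exp (\<eta> * of_real \<delta>)"
      unfolding h3_def h1_def exp_profile_def exp_add[symmetric] \<delta>_def N_def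
      by (simp add: algebra_simps)
    have "norm (h3 - h1) = norm h1 * norm (exp (\<eta> * of_real \<delta>) - 1)"
      unfolding norm_mult[symmetric] h31 by (simp add: algebra_simps)
    also have "\<dots> \<le> H * (H * (e * (4 / N)))"
      using hH[of "s + 1" "k + 2"] expH[OF n\<delta>e] H mult_left_mono[OF \<delta>4 e] e \<delta>0
      by (intro mult_mono order_trans[OF norm_exp_minus_one_le]) (auto simp: h1_def n\<delta> intro!: mult_mono)
    finally have "norm (h3 - h1) \<le> 4 * H\<^sup>2 * e / N"
      by (simp add: power2_eq_square mult_ac)
    then have "norm (z * (h3 - h1)) \<le> e / N * (4 * H\<^sup>2 * e / N)"
      unfolding norm_mult nz using e N by (intro mult_left_mono) auto
    then have T2: "norm (z * (h3 - h1)) \<le> 4 * H\<^sup>2 * e\<^sup>2 / N\<^sup>2"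
      by (simp add: power2_eq_square mult_ac)
    have "z - \<eta> / of_real m = \<eta> * of_real (1 / N - 1 / m)"
      by (simp add: z_def algebra_simps divide_inverse)
    moreover have "1 / N - 1 / m = (c - 1) / (N * m)"
      using N mge by (simp add: divide_simps) (simp add: m_def)
    moreover have "\<bar>(c - 1) / (N * m)\<bar> \<le> (c + 1) / (N * (N / 2))"
      unfolding abs_divide using N mge c
      by (intro frac_le) (auto simp: abs_mult)
    ultimately have "norm (z - \<eta> / of_real m) \<le> e * ((c + 1) / (N * (N / 2)))"
      using e by (simp only: norm_mult norm_of_real e_def[symmetric]) (intro mult_left_mono)
    then have "norm ((z - \<eta> / of_real m) * h1) \<le> e * ((c + 1) / (N * (N / 2))) * H"
      unfolding norm_mult using hH[of "s + 1" "k + 2"] e c N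
      by (intro mult_mono) (auto simp: h1_def)
    then have T3: "norm ((z - \<eta> / of_real m) * h1) \<le> 2 * H * e * (c + 1) / N\<^sup>2"
      by (simp add: power2_eq_square mult_ac)
    have "norm (\<eta>\<^sup>2 * h0 + \<eta> * h1') \<le> e\<^sup>2 * H + e * H"
      using hH[of s "k + 2"] hH[of "s + 1" "k + 1"] e
      by (intro norm_triangle_le add_mono)
         (auto simp: norm_mult norm_power h0_def h1'_def e_def intro!: mult_left_mono)
    then have "norm ((\<eta>\<^sup>2 * h0 + \<eta> * h1') / of_real (m * m')) \<le> (e\<^sup>2 * H + e * H) / (N / 2 * (N / 2))"
      unfolding norm_divide norm_of_real using mult_mono[OF mge(1,2)] mge N e H
      by (intro frac_le) (auto simp: abs_mult)
    then have T4: "norm ((\<eta>\<^sup>2 * h0 + \<eta> * h1') / of_real (m * m')) \<le> 4 * (e\<^sup>2 + e) * H / N\<^sup>2"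
      by (simp add: power2_eq_square algebra_simps)
    have "h4 - h3 - \<eta> / of_real m * h1 - (\<eta>\<^sup>2 * h0 + \<eta> * h1') / of_real (m * m') =
      (h4 - h3 - z * h3) + z * (h3 - h1) + (z - \<eta> / of_real m) * h1 -
      (\<eta>\<^sup>2 * h0 + \<eta> * h1') / of_real (m * m')"
      by (simp add: algebra_simps)
    also have "norm \<dots> \<le> H\<^sup>2 * e\<^sup>2 / N\<^sup>2 + 4 * H\<^sup>2 * e\<^sup>2 / N\<^sup>2 + 2 * H * e * (c + 1) / N\<^sup>2 +
      4 * (e\<^sup>2 + e) * H / N\<^sup>2"
      by (intro order_trans[OF norm_triangle_ineq4] add_mono order_trans[OF norm_triangle_ineq] T1 T2 T3 T4)
    also have "\<dots> = Q / N\<^sup>2" by (simp add: Q_def add_divide_distrib)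
    finally show ?thesis
      unfolding mm h4_def h3_def h1_def h0_def h1'_def N_def .
  qed
  then show ?thesis using Q by blast
qed

text \<open>The distance of \<open>g\<close> from the profile obeys the Gronwall inequality; at
  \<open>(n, 0)\<close> with \<open>n \<ge> 1\<close> the profile equals \<open>exp \<eta>\<close>,
  so the error is of order \<open>1 / n\<close>.\<close>

lemma recurrence_tendsto_exp:
  fixes g :: "nat \<Rightarrow> nat \<Rightarrow> complex" and \<eta> :: complex and c :: real
  assumes c: "c > 0"
    and g2: "\<And>s k. s \<le> 2 \<Longrightarrow> g s k = 1"
    and g3: "\<And>k. g 3 k = 1 + \<eta> / of_real (c + k + 2) + \<eta> / of_real ((c + k + 2) * (c + k + 1))"
    and rec: "\<And>s k. g (s + 4) k = g (s + 3) (k + 1) +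
      \<eta> / of_real (c + real (s + k) + 3) * g (s + 1) (k + 2) +
      (\<eta>\<^sup>2 * g s (k + 2) + \<eta> * g (s + 1) (k + 1)) /
        of_real ((c + real (s + k) + 3) * (c + real (s + k) + 2))"
  shows "(\<lambda>n. g n 0) \<longlonglongrightarrow> exp \<eta>"
proof -
  define e where "e = norm \<eta>"
  define H where "H = exp e"
  have e: "e \<ge> 0" and H: "H \<ge> 1" by (auto simp: e_def H_def)
  define h where "h = exp_profile \<eta>"
  define d where "d s k = norm (g s k - h s k)" for s k
  obtain Q where Q: "Q \<ge> 0" and res: "\<And>s k. norm (h (s + 4) k - h (s + 3) (k + 1) -
      \<eta> / of_real (c + real (s + k) + 3) * h (s + 1) (k + 2) -
      (\<eta>\<^sup>2 * h s (k + 2) + \<eta> * h (s + 1) (k + 1)) /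
        of_real ((c + real (s + k) + 3) * (c + real (s + k) + 2))) \<le> Q / (real (s + k + 4))\<^sup>2"
    unfolding h_def using exp_profile_residual[OF c] by blast
  \<comment> \<open>One \<open>L\<close> serves all three coefficients, as \<open>m\<close> and
    \<open>m * m'\<close> are at least \<open>N / 2\<close>. In \<open>B\<close> the summand
    \<open>3 * H * e\<close> stems from the profile and \<open>4 * e\<close> from
    \<open>g 3\<close>.\<close>
  define L where "L = 2 * e + 2 * e\<^sup>2"
  define B where "B = 3 * H * e + 4 * e"
  have L: "L \<ge> 0" and B: "B \<ge> 0" using e H by (auto simp: L_def B_def)
  have base: "d s k \<le> B / real (s + k)" if s: "s \<le> 3" "s + k \<ge> 1" for s k
  proof -
    define N where "N = real (s + k)"
    have N: "N \<ge> 1" using s(2) unfolding N_def by linarith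
    define z where "z = \<eta> * of_real (real s / N)"
    have nz: "norm z = e * (real s / N)" using N by (simp add: norm_mult norm_divide e_def z_def)
    have "norm z \<le> e * 1" unfolding nz using e N by (intro mult_left_mono) (auto simp: N_def divide_simps)
    then have "exp (norm z) \<le> H" by (simp add: H_def)
    then have "norm (exp z - 1) \<le> H * (e * (3 / N))"
      using e N s H
      by (intro order_trans[OF norm_exp_minus_one_le] mult_mono) (auto simp: nz intro!: mult_left_mono divide_right_mono)
    then have h: "norm (h s k - 1) \<le> 3 * H * e / N"
      by (simp add: h_def exp_profile_def N_def mult_ac z_def)
    have g: "norm (g s k - 1) \<le> 4 * e / N"
    proof (cases "s \<le> 2")
      case True
      then show ?thesis using g2 e N by simp
    next
      case False
      then have s: "s = 3" using s by simp
      have N': "N = real k + 3" by (simp add: N_def s)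
      have "norm (\<eta> / complex_of_real (c + k + 2)) \<le> e / (N / 2)"
        unfolding norm_divide norm_of_real e_def using N' c by (intro frac_le) auto
      moreover have "N / 2 * 1 \<le> (c + k + 2) * (c + k + 1)"
        using N' c by (intro mult_mono) auto
      then have "norm (\<eta> / complex_of_real ((c + k + 2) * (c + k + 1))) \<le> e / (N / 2)"
        unfolding norm_divide norm_of_real e_def using N' c by (intro frac_le) auto
      ultimately have "norm (\<eta> / of_real (c + k + 2) + \<eta> / of_real ((c + k + 2) * (c + k + 1))) \<le>
        e / (N / 2) + e / (N / 2)"
        by (intro norm_triangle_le add_mono)
      then show ?thesis unfolding s g3 by simp
    qed
    have "d s k \<le> norm (g s k - 1) + norm (h s k - 1)"
      unfolding d_def by (rule norm_diff_triangle_le[of _ 1]) (auto simp: norm_minus_commute)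
    also have "\<dots> \<le> B / N" using g h by (simp add: B_def add_divide_distrib)
    finally show ?thesis by (simp add: N_def)
  qed
  have step: "d (s + 4) k \<le> d (s + 3) (k + 1) +
      L / real (s + k + 4) * (d (s + 1) (k + 2) + d s (k + 2) + d (s + 1) (k + 1)) +
      Q / (real (s + k + 4))\<^sup>2" for s k
  proof -
    define N where "N = real (s + k + 4)"
    have N: "N \<ge> 4" by (simp add: N_def)
    define m where "m = c + real (s + k) + 3"
    define m' where "m' = c + real (s + k) + 2"
    define r where "r = h (s + 4) k - h (s + 3) (k + 1) - \<eta> / of_real m * h (s + 1) (k + 2) -
      (\<eta>\<^sup>2 * h s (k + 2) + \<eta> * h (s + 1) (k + 1)) / of_real (m * m')"
    have m: "m \<ge> N / 2" "m' \<ge> 1" using c by (auto simp: m_def m'_def N_def)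
    have mm: "m * m' \<ge> N / 2" using mult_mono[OF m] m N by simp
    have k1: "norm (\<eta> / complex_of_real m) \<le> L / N"
    proof -
      have "norm (\<eta> / complex_of_real m) \<le> e / (N / 2)"
        unfolding norm_divide norm_of_real e_def using m N by (intro frac_le) auto
      also have "\<dots> \<le> L / N" using N by (simp add: L_def divide_right_mono)
      finally show ?thesis .
    qed
    have k2: "norm (\<eta> / complex_of_real (m * m')) \<le> L / N"
    proof -
      have "norm (\<eta> / complex_of_real (m * m')) \<le> e / (N / 2)"
        unfolding norm_divide norm_of_real e_def using mm N by (intro frac_le) auto
      also have "\<dots> \<le> L / N" using N by (simp add: L_def divide_right_mono)
      finally show ?thesis .
    qed
    have k3: "norm (\<eta>\<^sup>2 / complex_of_real (m * m')) \<le> L / N"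
    proof -
      have "norm (\<eta>\<^sup>2 / complex_of_real (m * m')) \<le> e\<^sup>2 / (N / 2)"
        unfolding norm_divide norm_of_real e_def norm_power using mm N by (intro frac_le) auto
      also have "\<dots> \<le> L / N" using N e by (simp add: L_def divide_right_mono)
      finally show ?thesis .
    qed
    have tri: "norm (u + (v + w + x) - z) \<le> norm u + (norm v + norm w + norm x) + norm z"
      for u v w x z :: complex
      by (intro order_trans[OF norm_triangle_ineq4] add_mono norm_triangle_le order_refl)
    \<comment> \<open>The recurrence of \<open>h\<close>, which holds up to the residual
      \<open>r\<close>, is subtracted from that of \<open>g\<close>.\<close>
    have "g (s + 4) k - h (s + 4) k = (g (s + 3) (k + 1) - h (s + 3) (k + 1)) +
      (\<eta> / of_real m * (g (s + 1) (k + 2) - h (s + 1) (k + 2)) +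
       \<eta>\<^sup>2 / of_real (m * m') * (g s (k + 2) - h s (k + 2)) +
       \<eta> / of_real (m * m') * (g (s + 1) (k + 1) - h (s + 1) (k + 1))) - r"
      unfolding rec m_def[symmetric] m'_def[symmetric] r_def
      by (simp add: algebra_simps add_divide_distrib diff_divide_distrib)
    also have "norm \<dots> \<le> d (s + 3) (k + 1) +
      (L / N * d (s + 1) (k + 2) + L / N * d s (k + 2) + L / N * d (s + 1) (k + 1)) + Q / N\<^sup>2"
      unfolding d_def using res[of s k, folded m_def m'_def] k1 k2 k3
      by (intro order_trans[OF tri] add_mono)
         (auto simp only: norm_mult r_def N_def intro!: mult_right_mono norm_ge_zero)
    finally show ?thesis by (simp add: d_def N_def algebra_simps)
  qed
  define E where "E = (9 * Q + 3 * B) * exp (9 * L + 1)"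
  have bound: "norm (g n 0 - exp \<eta>) \<le> E / n" if "n \<ge> 1" for n
  proof -
    have "d n 0 \<le> (9 * Q + 3 * B) / n * (1 + (9 * L + 1) / n) ^ n"
      using discrete_gronwall[where d = d, OF L Q B base step that, of 0 n] by simp
    \<comment> \<open>The growth factor accumulated over \<open>n\<close> steps stays bounded, so
      the prefactor of order \<open>1 / n\<close> decides.\<close>
    also have "\<dots> \<le> (9 * Q + 3 * B) / n * exp (9 * L + 1)"
      using exp_ge_one_plus_x_over_n_power_n[where x = "9 * L + 1" and n = n] L Q B that
      by (intro mult_left_mono) simp_all
    finally have "d n 0 \<le> E / n" by (simp add: E_def)
    then show ?thesis using that by (simp add: d_def h_def exp_profile_def)
  qed
  have "(\<lambda>n. g n 0 - exp \<eta>) \<longlonglongrightarrow> 0"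
  proof (rule Lim_null_comparison)
    show "\<forall>\<^sub>F n in sequentially. norm (g n 0 - exp \<eta>) \<le> E / n"
      by (intro eventually_sequentiallyI[of 1] bound)
    show "(\<lambda>n. E / real n) \<longlonglongrightarrow> 0" by (rule lim_const_over_n)
  qed
  then show ?thesis by (rule LIM_zero_cancel)
qed

section \<open>Characteristic functions\<close>

lemma diag_gf_at_one:
  "diag_gf (of_real \<alpha>) (of_real \<beta>) y n 1 =
    (\<Sum>T\<in>ab_staircases n. of_real (wt n \<alpha> \<beta> T) * y ^ X3 n T :: 'a::{real_algebra_1,comm_ring_1})"
proof -
  have "row_weight n 1 1 1 i = (1 :: 'a)" for i by (simp add: row_weight_def)
  then show ?thesis by (simp add: diag_gf_def stair_gf_def wt_def)
qed

text \<open>The type stays open: the real instance yields positivity of \<open>Z\<close>, the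
  complex one the denominator of the characteristic function.\<close>

lemma of_real_Z_eq:
  assumes "\<alpha> > 0" "\<beta> > 0"
  shows "(of_real (Z n \<alpha> \<beta>) :: 'a::real_field) = norm_const (of_real \<alpha>) (of_real \<beta>) n 0"
  using diag_gf_one[of "of_real \<alpha> :: 'a" "of_real \<beta>" n 0] diag_gf_at_one[of \<alpha> \<beta> "1 :: 'a" n] assms
  by (simp add: Z_def)

lemma Z_pos:
  assumes "\<alpha> > 0" "\<beta> > 0"
  shows "Z n \<alpha> \<beta> > 0"
  using of_real_Z_eq[OF assms, of n, where 'a = real] assms
  by (auto simp: norm_const_def intro!: mult_pos_pos pochhammer_pos add_pos_pos)

text \<open>\<open>embed_pmf\<close> has the intended values once the function is non-negative with
  total mass 1; positivity of \<open>Z\<close> enters here.\<close>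

lemma pmf_stair_pmf:
  assumes "\<alpha> > 0" "\<beta> > 0"
  shows "pmf (stair_pmf n \<alpha> \<beta>) T = (if T \<in> ab_staircases n then wt n \<alpha> \<beta> T / Z n \<alpha> \<beta> else 0)"
  unfolding stair_pmf_def
proof (rule pmf_embed_pmf)
  let ?f = "\<lambda>T. if T \<in> ab_staircases n then wt n \<alpha> \<beta> T / Z n \<alpha> \<beta> else 0"
  have wt: "wt n \<alpha> \<beta> T \<ge> 0" for T using assms by (simp add: wt_def)
  then show nonneg: "0 \<le> ?f T" for T using Z_pos[OF assms, of n] by simp
  have "(\<integral>\<^sup>+T. ennreal (?f T) \<partial>count_space UNIV) = (\<Sum>T\<in>ab_staircases n. ennreal (?f T))"
    by (rule nn_integral_count_space') auto
  also have "\<dots> = ennreal (\<Sum>T\<in>ab_staircases n. ?f T)"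
    by (rule sum_ennreal) (rule nonneg)
  also have "(\<Sum>T\<in>ab_staircases n. ?f T) = 1"
    using Z_pos[OF assms, of n] by (simp add: sum_divide_distrib[symmetric] Z_def)
  finally show "(\<integral>\<^sup>+T. ennreal (?f T) \<partial>count_space UNIV) = 1" by simp
qed

lemma iexp_mult_of_nat: "iexp (t * real k) = iexp t ^ k"
  by (simp add: exp_of_nat_mult[symmetric] mult_ac)

lemma char_X3_law:
  assumes "\<alpha> > 0" "\<beta> > 0"
  shows "char (X3_law n \<alpha> \<beta>) t = norm_gf (of_real \<alpha>) (of_real \<beta>) (iexp t) n 0"
proof -
  have "char (X3_law n \<alpha> \<beta>) t = (\<integral>T. iexp (t * real (X3 n T)) \<partial>measure_pmf (stair_pmf n \<alpha> \<beta>))"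
    by (simp add: char_def X3_law_def)
  also have "\<dots> = (\<Sum>T\<in>ab_staircases n. pmf (stair_pmf n \<alpha> \<beta>) T *\<^sub>R iexp (t * real (X3 n T)))"
    by (rule integral_measure_pmf) (auto simp: set_pmf_eq pmf_stair_pmf[OF assms] split: if_splits)
  also have "\<dots> = (\<Sum>T\<in>ab_staircases n. of_real (wt n \<alpha> \<beta> T) * iexp t ^ X3 n T / of_real (Z n \<alpha> \<beta>))"
    unfolding iexp_mult_of_nat by (intro sum.cong) (auto simp: pmf_stair_pmf[OF assms] scaleR_conv_of_real)
  also have "\<dots> = diag_gf (of_real \<alpha>) (of_real \<beta>) (iexp t) n 1 / of_real (Z n \<alpha> \<beta>)"
    by (simp add: diag_gf_at_one sum_divide_distrib)
  finally show ?thesis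
    using of_real_Z_eq[OF assms, of n, where 'a = complex] by (simp add: norm_gf_def)
qed

lemma char_poisson_one: "char (measure_pmf (map_pmf real (poisson_pmf 1))) t = exp (iexp t - 1)"
proof -
  define f where "f k = pmf (poisson_pmf 1) k *\<^sub>R iexp (t * real k)" for k
  have f: "f k = exp (- 1) *\<^sub>R (iexp t ^ k /\<^sub>R fact k)" for k
    unfolding f_def iexp_mult_of_nat by (simp add: divide_inverse mult_ac)
  \<comment> \<open>As \<open>iexp t\<close> has modulus 1, the norms are the terms of the
    exponential series at 1, up to a constant factor.\<close>
  have "summable (\<lambda>k. norm (f k))"
    using summable_mult[OF summable_exp[of "1::real"], of "exp (-1)"]
    by (simp add: f norm_power)
  then have int: "integrable (count_space UNIV) f"
    by (simp add: integrable_count_space_nat_iff)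
  have "char (measure_pmf (map_pmf real (poisson_pmf 1))) t = (\<integral>k. iexp (t * real k) \<partial>measure_pmf (poisson_pmf 1))"
    by (simp add: char_def)
  also have "\<dots> = (\<integral>k. f k \<partial>count_space UNIV)"
    unfolding measure_pmf_eq_density f_def by (rule integral_density) auto
  also have "\<dots> = suminf f" by (rule integral_count_space_nat[OF int])
  also have "f sums (exp (- 1) *\<^sub>R exp (iexp t))"
    unfolding f by (intro sums_scaleR_right exp_converges)
  then have "suminf f = exp (- 1) *\<^sub>R exp (iexp t)" by (rule sums_unique[symmetric])
  also have "\<dots> = exp (iexp t - 1)"
    by (simp add: scaleR_conv_of_real exp_diff exp_minus divide_inverse flip: exp_of_real)
  finally show ?thesis .
qed

text \<open>Levy's theorem asks for the Borel sigma algebra, whereas every set is measurable for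
  \<^const>\<open>measure_pmf\<close>.\<close>

lemma weak_conv_m_measure_pmfI:
  fixes p :: "nat \<Rightarrow> real pmf" and q :: "real pmf"
  assumes "\<And>t. (\<lambda>n. char (measure_pmf (p n)) t) \<longlonglongrightarrow> char (measure_pmf q) t"
  shows "weak_conv_m (\<lambda>n. measure_pmf (p n)) (measure_pmf q)"
proof -
  define D where "D r = distr (measure_pmf r) borel (\<lambda>x::real. x)" for r
  have dist: "real_distribution (D r)" for r
    unfolding real_distribution_def real_distribution_axioms_def D_def
    by (auto intro!: measure_pmf.prob_space_distr)
  have char: "char (D r) = char (measure_pmf r)" for r
    by (simp add: fun_eq_iff char_def D_def integral_distr)
  have cdf: "cdf (D r) = cdf (measure_pmf r)" for r
    by (simp add: fun_eq_iff cdf_def D_def measure_distr)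
  have "weak_conv_m (\<lambda>n. D (p n)) (D q)"
    using dist assms by (intro levy_continuity) (simp_all add: char)
  then show ?thesis by (simp add: weak_conv_m_def cdf)
qed

theorem theorem4p6:
  fixes \<alpha> \<beta> :: real
  assumes "\<alpha> > 0" and "\<beta> > 0"
  shows "weak_conv_m (\<lambda>n. X3_law (n + 3) \<alpha> \<beta>)
           (measure_pmf (map_pmf real (poisson_pmf 1)))"
proof -
  define c where "c = 1 / \<alpha> + 1 / \<beta>"
  have c: "c > 0" using assms by (simp add: c_def add_pos_pos)
  let ?a = "complex_of_real \<alpha>" and ?b = "complex_of_real \<beta>"
  have cc: "1 / ?a + 1 / ?b = of_real c" by (simp add: c_def)
  have nz: "1 / ?a + 1 / ?b + of_nat j \<noteq> 0" for j
  proof -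
    have "c + real j \<noteq> 0" using c by simp
    then have "of_real (c + real j) \<noteq> (0 :: complex)" by (simp only: of_real_eq_0_iff not_False_eq_True)
    then show ?thesis unfolding cc by simp
  qed
  \<comment> \<open>Here \<eta> is \<open>iexp t - 1\<close>, and \<open>exp \<eta>\<close> is the
    characteristic function of the Poisson law.\<close>
  have "(\<lambda>n. char (X3_law n \<alpha> \<beta>) t) \<longlonglongrightarrow> exp (iexp t - 1)" for t
    unfolding char_X3_law[OF assms]
  proof (rule recurrence_tendsto_exp[OF c])
    note rec = norm_gf_rec[where a = ?a and b = ?b and y = "iexp t", OF _ _ nz, unfolded cc]
    have ab: "?a \<noteq> 0" "?b \<noteq> 0" using assms by auto
    show "norm_gf ?a ?b (iexp t) s k = 1" if "s \<le> 2" for s k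
    proof -
      have "s = 0 \<or> s = 1 \<or> s = 2" using that by linarith
      then show ?thesis using rec(1-3)[OF ab] by blast
    qed
    show "norm_gf ?a ?b (iexp t) 3 k = 1 + (iexp t - 1) / of_real (c + k + 2) +
        (iexp t - 1) / of_real ((c + k + 2) * (c + k + 1))" for k
      unfolding rec(4)[OF ab] by (simp add: add_ac)
    show "norm_gf ?a ?b (iexp t) (s + 4) k = norm_gf ?a ?b (iexp t) (s + 3) (k + 1) +
        (iexp t - 1) / of_real (c + real (s + k) + 3) * norm_gf ?a ?b (iexp t) (s + 1) (k + 2) +
        ((iexp t - 1)\<^sup>2 * norm_gf ?a ?b (iexp t) s (k + 2) +
         (iexp t - 1) * norm_gf ?a ?b (iexp t) (s + 1) (k + 1)) /
          of_real ((c + real (s + k) + 3) * (c + real (s + k) + 2))" for s k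
    proof -
      have m: "of_real c + of_nat (s + k + 3) = complex_of_real (c + real (s + k) + 3)"
        "of_real c + of_nat (s + k + 2) = complex_of_real (c + real (s + k) + 2)" by simp_all
      show ?thesis unfolding rec(5)[OF ab] m of_real_mult ..
    qed
  qed
  \<comment> \<open>The limit holds along all sizes; the shift by 3 passes to the sizes in the
    statement.\<close>
  from LIMSEQ_ignore_initial_segment[OF this, of 3] show ?thesis
    unfolding X3_law_def by (intro weak_conv_m_measure_pmfI) (simp only: char_poisson_one)
qed

end
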